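(* The infinite product below converges (as the limit of its partial products) and $$\prod_{n\geq 1}\left(\frac{3n+1}{3n+2}\right)^{(-1)^n}=\frac{2}{\sqrt{3}}.$$ *)

theory Defs
  imports Complex_Main
begin

end

theory Submission
  imports Defs "HOL-Probability.Characteristic_Functions" "HOL-Real_Asymp.Real_Asymp"
begin

text \<open>
  The product is a quotient of two values of Euler's product
  \<open>sin (pi x) / (pi x) = (\<Prod>k\<ge>1. 1 - x\<^sup>2 / k\<^sup>2)\<close>, at \<open>x = 1/6\<close> and \<open>x = 1/3\<close>. Grouping the factors with \<open>n = 2k - 1\<close> and \<open>n = 2k\<close>
  puts a pair of integers symmetric about \<open>6k\<close> both above and below the fraction line:
  \<open>(6k - 1) (6k + 1) / ((6k - 2) (6k + 2)) = (1 - (1/6)\<^sup>2 / k\<^sup>2) / (1 - (1/3)\<^sup>2 / k\<^sup>2)\<close>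
  (\<open>alternating_pair_eq_sinc_factors\<close>). By \<open>sin_product_formula_real'\<close> the partial products of even length converge to
  \<open>(sin (pi/6) / (pi/6)) / (sin (pi/3) / (pi/3)) = 2 / sqrt 3\<close>. Those of odd length have one further
  factor, which tends to 1, so they have the same limit.
\<close>

lemma alternating_pair_eq_sinc_factors:
  fixes k :: nat
  assumes "k \<ge> 1"
  shows "((3 * real (2 * k - 1) + 1) / (3 * real (2 * k - 1) + 2)) powi ((- 1) ^ (2 * k - 1)) *
         ((3 * real (2 * k) + 1) / (3 * real (2 * k) + 2)) powi ((- 1) ^ (2 * k)) =
         (1 - (1/6)\<^sup>2 / (real k)\<^sup>2) / (1 - (1/3)\<^sup>2 / (real k)\<^sup>2)"
proof -
  have sign_odd: "(- 1 :: int) ^ (2 * k - 1) = - 1"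
    using assms by (simp add: uminus_power_if)
  have real_pred: "real (2 * k - 1) = 2 * real k - 1"
    using assms by (simp add: of_nat_diff)
  have k: "real k \<ge> 1"
    using assms by simp
  then have sq: "1 \<le> (real k)\<^sup>2"
    by simp
  have lhs: "((6 * real k - 1) / (6 * real k - 2)) * ((6 * real k + 1) / (6 * real k + 2)) =
        (36 * (real k)\<^sup>2 - 1) / (36 * (real k)\<^sup>2 - 4)"
    by (simp add: algebra_simps power2_eq_square)
  have "(1 - (1/6)\<^sup>2 / (real k)\<^sup>2) / (1 - (1/3)\<^sup>2 / (real k)\<^sup>2) =
        (36 * (real k)\<^sup>2 - 1) / (36 * (real k)\<^sup>2 - 4)"
    using sq k by (simp add: field_simps power2_eq_square)
  with lhs show ?thesis
    unfolding sign_odd real_pred by (simp add: power_int_minus algebra_simps)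
qed

theorem mainTheorem2:
  shows "(\<lambda>N::nat. \<Prod>n=1..N. ((3 * real n + 1) / (3 * real n + 2)) powi ((- 1) ^ n))
           \<longlonglongrightarrow> 2 / sqrt 3"
proof -
  define f where "f n = ((3 * real n + 1) / (3 * real n + 2)) powi ((- 1) ^ n)" for n :: nat
  define P where "P N = (\<Prod>n=1..N. f n)" for N
  have even_eq: "P (2 * m) = (\<Prod>k=1..m. 1 - (1/6)\<^sup>2 / (real k)\<^sup>2) /
                             (\<Prod>k=1..m. 1 - (1/3)\<^sup>2 / (real k)\<^sup>2)" for m
  proof (induction m)
    case 0
    then show ?case by (simp add: P_def)
  next
    case (Suc m)
    have "P (2 * Suc m) = P (2 * m) * (f (2 * Suc m - 1) * f (2 * Suc m))"
      by (simp add: P_def)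
    also have "f (2 * Suc m - 1) * f (2 * Suc m) =
        (1 - (1/6)\<^sup>2 / (real (Suc m))\<^sup>2) / (1 - (1/3)\<^sup>2 / (real (Suc m))\<^sup>2)"
      unfolding f_def by (rule alternating_pair_eq_sinc_factors) simp
    finally show ?case
      by (simp add: Suc.IH)
  qed
  have "(\<lambda>m. P (2 * m)) \<longlonglongrightarrow>
          (sin (pi * (1/6)) / (pi * (1/6))) / (sin (pi * (1/3)) / (pi * (1/3)))"
    unfolding even_eq
    by (intro tendsto_divide sin_product_formula_real') (simp_all add: sin_60)
  also have "(sin (pi * (1/6)) / (pi * (1/6))) / (sin (pi * (1/3)) / (pi * (1/3))) = 2 / sqrt 3"
    by (simp add: sin_30 sin_60)
  finally have even_lim: "(\<lambda>m. P (2 * m)) \<longlonglongrightarrow> 2 / sqrt 3" .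
  have "(\<lambda>m. f (2 * m + 1)) = (\<lambda>m. 1 + 1 / (4 + 6 * real m))"
    by (auto simp: f_def power_int_minus field_simps)
  moreover have "(\<lambda>m. 1 + 1 / (4 + 6 * real m)) \<longlonglongrightarrow> 1"
    by real_asymp
  ultimately have "(\<lambda>m. f (2 * m + 1)) \<longlonglongrightarrow> 1"
    by simp
  from tendsto_mult[OF even_lim this] have odd_lim: "(\<lambda>m. P (2 * m + 1)) \<longlonglongrightarrow> 2 / sqrt 3"
    by (simp add: P_def)
  have "P \<longlonglongrightarrow> 2 / sqrt 3"
    using limseq_even_odd even_lim odd_lim by blast
  then show ?thesis
    unfolding P_def f_def .
qed

end
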